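(* For every integer $m\ge 1$, the cardinality of $S_m=\{\nu\in\mathcal{F}:\rho^*(1)^\nu=2^m\}$ is given by $$\#S_m=\sum_{(N_1,\dots,N_m)\in\mathcal{Q}_m}\ \prod_{k=1}^m\binom{N_k-1+\#I_k}{N_k}.$$ Moreover, for every $0<\varepsilon\le 1$, with $m(\varepsilon):=\lfloor\log_2(1/\varepsilon)\rfloor$, $$\#\Lambda(\varepsilon,\rho^*(1))=\sum_{k=0}^{m(\varepsilon)}\#S_k=1+\sum_{k=1}^{m(\varepsilon)}\ \sum_{(N_1,\dots,N_k)\in\mathcal{Q}_k}\ \prod_{j=1}^k\binom{N_j-1+\#I_j}{N_j}.$$
   Context: $\mathbb{N}_0=\{0,1,2,\dots\}$. $\mathcal{F}$ is the set of all sequences $\nu=(\nu_1,\nu_2,\dots)$ with entries in $\mathbb{N}_0$ and only finitely many nonzero entries; for a positive sequence $\rho$, $\rho^\nu=\prod_j\rho_j^{\nu_j}$ and $\rho^{-\nu}=1/\rho^\nu$. Let $I_1=\{1,2\}$ and $I_k=\{j\in\mathbb{N}:2^{k-1}<j\le 2^k\}$ for $k\ge2$, so $\#I_1=2$ and $\#I_k=2^{k-1}$ for $k\ge 2$. The sequence $\rho^*(1)$ is defined by $\rho^*_j(1)=2^k$ for $j\in I_k$, $k=1,2,\dots$. For $\varepsilon>0$, $\Lambda(\varepsilon,\rho)=\{\nu\in\mathcal{F}:\rho^{-\nu}\ge\varepsilon\}$. For $m\in\mathbb{N}_0$, $S_m=\{\nu\in\mathcal{F}:\rho^*(1)^\nu=2^m\}$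 (so $\#S_0=1$). For $m\ge1$, $\mathcal{Q}_m=\{(N_1,\dots,N_m)\in\mathbb{N}_0^m:\sum_{k=1}^m kN_k=m\}$. *)

theory Defs
  imports "HOL-Analysis.Analysis"
begin

(* Sequences (x_1, x_2, ...) are functions on nat whose value at 0 carries no information.
   For multi-indices that value is pinned to 0, so that distinct functions represent
   distinct sequences and cardinalities are the intended ones. *)
definition multi_indices :: "(nat \<Rightarrow> nat) set"
  where "multi_indices = {\<nu>. \<nu> 0 = 0 \<and> finite {j. \<nu> j \<noteq> 0}}"

(* The product over the support; all other factors of the infinite product equal 1. *)
definition mpow :: "(nat \<Rightarrow> real) \<Rightarrow> (nat \<Rightarrow> nat) \<Rightarrow> real"
  where "mpow \<rho> \<nu> = (\<Prod>j | \<nu> j \<noteq> 0. \<rho> j ^ \<nu> j)"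

definition Lambda_set :: "real \<Rightarrow> (nat \<Rightarrow> real) \<Rightarrow> (nat \<Rightarrow> nat) set"
  where "Lambda_set \<epsilon> \<rho> = {\<nu> \<in> multi_indices. 1 / mpow \<rho> \<nu> \<ge> \<epsilon>}"

(* Only the blocks with k >= 1 are meaningful. *)
definition I_block :: "nat \<Rightarrow> nat set"
  where "I_block k = (if k = 1 then {1, 2} else {j. 2 ^ (k - 1) < j \<and> j \<le> 2 ^ k})"

definition rho_star_one :: "nat \<Rightarrow> real"
  where "rho_star_one j = 2 ^ (THE k. k \<ge> 1 \<and> j \<in> I_block k)"

lemma I_block_unique:
  assumes "k \<ge> 1" "k' \<ge> 1" "j \<in> I_block k" "j \<in> I_block k'"
  shows "k = k'"
proof -
  have *: False if "a \<ge> 1" "a < b" "j \<in> I_block a" "j \<in> I_block b" for a b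
  proof -
    have "j \<le> 2 ^ a"
      using that(3) by (auto simp: I_block_def split: if_splits)
    also have "(2::nat) ^ a \<le> 2 ^ (b - 1)"
      using that by (intro power_increasing) auto
    also have "\<dots> < j"
      using that by (auto simp: I_block_def split: if_splits)
    finally show False by simp
  qed
  show ?thesis
    using *[of k k'] *[of k' k] assms by (meson linorder_less_linear)
qed

(* The definite description above is well defined on every block. *)
lemma rho_star_one_eq:
  assumes "k \<ge> 1" "j \<in> I_block k"
  shows "rho_star_one j = 2 ^ k"
proof -
  have "(THE k. k \<ge> 1 \<and> j \<in> I_block k) = k"
    using assms by (intro the_equality) (auto intro: I_block_unique)
  then show ?thesis
    by (simp add: rho_star_one_def)
qed

definition S_set :: "nat \<Rightarrow> (nat \<Rightarrow> nat) set"
  where "S_set m = {\<nu> \<in> multi_indices. mpow rho_star_one \<nu> = 2 ^ m}"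

(* m-tuples (N_1, ..., N_m) are extensional functions on {1..m}. *)
definition Q_set :: "nat \<Rightarrow> (nat \<Rightarrow> nat) set"
  where "Q_set m = {N \<in> {1..m} \<rightarrow>\<^sub>E UNIV. (\<Sum>k = 1..m. k * N k) = m}"

definition m_of :: "real \<Rightarrow> nat"
  where "m_of \<epsilon> = nat \<lfloor>log 2 (1 / \<epsilon>)\<rfloor>"

end

theory Submission
  imports Defs "HOL-Library.Multiset"
begin

(* All factors of mpow rho_star_one nu are powers of 2, so both S_m and Lambda are described by
   the exponent w(nu) = sum of w(j) nu_j, where w(j) is the number of the block containing j.
   A nu with w(nu) = m is supported on the blocks 1, ..., m; sorting by the block sums N_k
   splits S_m into classes, in each of which the restrictions of nu to the blocks are chosen
   independently, and stars and bars counts the choices on one block. *)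

section \<open>Stars and bars\<close>

text \<open>A function vanishing off the finite set \<open>A\<close> is the multiplicity function of
  exactly one multiset over \<open>A\<close>. This makes the known count of multisets of a given
  size available.\<close>

lemma weak_compositions_eq_count_image:
  assumes "finite A"
  shows "{f. (\<forall>x. x \<notin> A \<longrightarrow> f x = 0) \<and> sum f A = n} = count ` multisets_of_size A n"
proof (intro equalityI subsetI)
  fix f assume "f \<in> {f. (\<forall>x. x \<notin> A \<longrightarrow> f x = 0) \<and> sum f A = n}"
  then have f: "\<And>x. x \<notin> A \<Longrightarrow> f x = 0" "sum f A = n" by auto
  \<comment> \<open>Finite support is what makes \<open>Abs_multiset f\<close> a multiset with
    multiplicities \<open>f\<close>.\<close>
  have "finite {x. f x > 0}"
    by (rule finite_subset[OF _ assms]) (use f(1) in force)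
  then have c: "count (Abs_multiset f) = f"
    by simp
  have sub: "set_mset (Abs_multiset f) \<subseteq> A"
    using f(1) c by (metis not_in_iff subsetI)
  have "size (Abs_multiset f) = n"
    unfolding size_multiset_overloaded_eq c f(2)[symmetric]
    by (rule sum.mono_neutral_left[OF assms sub]) (simp add: c not_in_iff)
  with sub c show "f \<in> count ` multisets_of_size A n"
    by (auto simp: multisets_of_size_def intro!: image_eqI[of _ _ "Abs_multiset f"])
next
  fix f assume "f \<in> count ` multisets_of_size A n"
  then obtain X where X: "f = count X" "set_mset X \<subseteq> A" "size X = n"
    by (auto simp: multisets_of_size_def)
  have "sum f A = n"
    unfolding X(3)[symmetric] size_multiset_overloaded_eq X(1)
    by (rule sum.mono_neutral_right[OF assms X(2)]) (simp add: not_in_iff)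
  then show "f \<in> {f. (\<forall>x. x \<notin> A \<longrightarrow> f x = 0) \<and> sum f A = n}"
    using X by (auto simp: count_eq_zero_iff)
qed

lemma finite_weak_compositions:
  assumes "finite A"
  shows "finite {f. (\<forall>x. x \<notin> A \<longrightarrow> f x = (0::nat)) \<and> sum f A = n}"
  unfolding weak_compositions_eq_count_image[OF assms]
  by (intro finite_imageI finite_multisets_of_size assms)

text \<open>Since \<open>count\<close> is injective, this is the number of multisets. For empty
  \<open>A\<close> the truncated subtraction still gives the right values: 1 at
  \<open>n = 0\<close>, and \<open>(n - 1) choose n = 0\<close> otherwise.\<close>

lemma card_weak_compositions:
  assumes "finite A"
  shows "card {f. (\<forall>x. x \<notin> A \<longrightarrow> f x = (0::nat)) \<and> sum f A = n} = (n + card A - 1) choose n"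
proof -
  have "inj_on count (multisets_of_size A n)"
    by (rule inj_onI) (simp add: multiset_eq_iff)
  then show ?thesis
    unfolding weak_compositions_eq_count_image[OF assms]
    by (simp add: card_image card_multisets_of_size assms add.commute)
qed

text \<open>Induction on the set of blocks: by disjointness, the restriction to the new block and
  the remainder of the function determine it and can be chosen independently.\<close>

lemma card_block_compositions:
  fixes B :: "'i \<Rightarrow> 'a set"
  assumes "finite K" "\<And>k. k \<in> K \<Longrightarrow> finite (B k)" "disjoint_family_on B K"
  shows "card {f. (\<forall>x. x \<notin> (\<Union>k\<in>K. B k) \<longrightarrow> f x = (0::nat)) \<and> (\<forall>k\<in>K. sum f (B k) = N k)} =
    (\<Prod>k\<in>K. (N k + card (B k) - 1) choose N k)"
  using assms
proof (induction K rule: finite_induct)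
  case empty
  have "{f. \<forall>x::'a. f x = (0::nat)} = {\<lambda>_. 0}" by auto
  then show ?case by simp
next
  case (insert i K)
  define C where "C = (\<lambda>K. {f. (\<forall>x. x \<notin> (\<Union>k\<in>K. B k) \<longrightarrow> f x = (0::nat)) \<and> (\<forall>k\<in>K. sum f (B k) = N k)})"
  let ?A = "{f. (\<forall>x. x \<notin> B i \<longrightarrow> f x = (0::nat)) \<and> sum f (B i) = N i}"
  have disj: "B i \<inter> B k = {}" if "k \<in> K" for k
    using insert.prems(2) insert.hyps(2) that by (auto simp: disjoint_family_on_def)
  have "bij_betw (\<lambda>f. (\<lambda>x. if x \<in> B i then f x else 0, \<lambda>x. if x \<in> B i then 0 else f x))
    (C (insert i K)) (?A \<times> C K)"
  proof (rule bij_betw_byWitness[where f' = "\<lambda>(g, h) x. if x \<in> B i then g x else h x"])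
    show "\<forall>f\<in>C (insert i K).
      (case (\<lambda>x. if x \<in> B i then f x else 0, \<lambda>x. if x \<in> B i then 0 else f x)
       of (g, h) \<Rightarrow> \<lambda>x. if x \<in> B i then g x else h x) = f"
      by auto
    \<comment> \<open>The support of \<open>h\<close> lies in blocks disjoint from
      \<open>B i\<close>, so overwriting \<open>h\<close> on \<open>B i\<close> loses nothing and
      both components can be recovered.\<close>
    have "h x = 0" if "h \<in> C K" "x \<in> B i" for h x
      using disj that unfolding C_def by blast
    then show "\<forall>gh\<in>?A \<times> C K.
      (\<lambda>x. if x \<in> B i then (case gh of (g, h) \<Rightarrow> \<lambda>x. if x \<in> B i then g x else h x) x else 0,
       \<lambda>x. if x \<in> B i then 0 else (case gh of (g, h) \<Rightarrow> \<lambda>x. if x \<in> B i then g x else h x) x) = gh"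
      by (auto simp: fun_eq_iff)
    have *: "sum (\<lambda>x. if x \<in> B i then g x else h x) (B k) = sum h (B k)"
      if "k \<in> K" for g h :: "'a \<Rightarrow> nat" and k
      using disj[OF that] by (intro sum.cong) auto
    have "sum (\<lambda>x. if x \<in> B i then f x else 0) (B i) = sum f (B i)" for f :: "'a \<Rightarrow> nat"
      by (intro sum.cong) auto
    with * show "(\<lambda>f. (\<lambda>x. if x \<in> B i then f x else 0, \<lambda>x. if x \<in> B i then 0 else f x)) `
        C (insert i K) \<subseteq> ?A \<times> C K"
      by (auto simp: C_def)
    have "sum (\<lambda>x. if x \<in> B i then g x else h x) (B i) = sum g (B i)" for g h :: "'a \<Rightarrow> nat"
      by (intro sum.cong) auto
    with * show "(\<lambda>(g, h) x. if x \<in> B i then g x else h x) ` (?A \<times> C K) \<subseteq> C (insert i K)"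
      by (auto simp: C_def)
  qed
  then have "card (C (insert i K)) = card (?A \<times> C K)"
    by (rule bij_betw_same_card)
  also have "\<dots> = ((N i + card (B i) - 1) choose N i) * card (C K)"
    by (simp add: card_cartesian_product card_weak_compositions insert.prems(1))
  also have "card (C K) = (\<Prod>k\<in>K. (N k + card (B k) - 1) choose N k)"
    unfolding C_def using insert.prems
    by (intro insert.IH) (auto simp: disjoint_family_on_def)
  finally show ?case
    using insert.hyps by (simp add: C_def)
qed

section \<open>The blocks\<close>

lemma finite_I_block: "finite (I_block k)"
  by (simp add: I_block_def)

lemma disjoint_family_I_block: "disjoint_family_on I_block {1..m}"
  unfolding disjoint_family_on_def using I_block_unique
  by (metis atLeastAtMost_iff disjoint_iff)

lemma I_block_ge_1:
  assumes "j \<in> I_block k"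
  shows "1 \<le> j"
  using assms by (auto simp: I_block_def split: if_splits)

text \<open>For the least admissible \<open>k\<close>, failure at \<open>k - 1\<close> supplies the
  lower bound \<open>2 ^ (k - 1) < j\<close>.\<close>

lemma ex_I_block:
  assumes "j \<ge> 1"
  shows "\<exists>k\<ge>1. j \<in> I_block k"
proof -
  define k where "k = (LEAST k. k \<ge> 1 \<and> j \<le> 2 ^ k)"
  have "1 \<le> j \<and> j \<le> 2 ^ j" using assms by (simp add: less_imp_le)
  then have k: "k \<ge> 1" "j \<le> 2 ^ k"
    unfolding k_def by (metis (mono_tags, lifting) LeastI)+
  have "j \<in> I_block k"
  \<comment> \<open>At \<open>k = 1\<close> minimality gives no lower bound, the exponent 0 not
    being admissible; there the block is all of \<open>{1, 2}\<close>.\<close>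
  proof (cases "k = 1")
    case True
    with k assms show ?thesis by (auto simp: I_block_def)
  next
    case False
    have "\<not> (k - 1 \<ge> 1 \<and> j \<le> 2 ^ (k - 1))"
      using k(1) not_less_Least[of "k - 1" "\<lambda>k. k \<ge> 1 \<and> j \<le> 2 ^ k"]
      unfolding k_def[symmetric] by simp
    with False k show ?thesis by (auto simp: I_block_def)
  qed
  with k show ?thesis by blast
qed

text \<open>The description is copied from \<open>rho_star_one\<close>, so that
  \<open>rho_star_one j = 2 ^ block_index j\<close> holds even at \<open>j = 0\<close>, where no
  block exists and the value is unspecified.\<close>

definition block_index :: "nat \<Rightarrow> nat"
  where "block_index j = (THE k. k \<ge> 1 \<and> j \<in> I_block k)"

lemma block_index_eq:
  assumes "k \<ge> 1" "j \<in> I_block k"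
  shows "block_index j = k"
  unfolding block_index_def using assms by (intro the_equality) (auto intro: I_block_unique)

lemma block_index_props:
  assumes "j \<ge> 1"
  shows "block_index j \<ge> 1" "j \<in> I_block (block_index j)"
  using ex_I_block[OF assms] block_index_eq by auto

definition weight :: "(nat \<Rightarrow> nat) \<Rightarrow> nat"
  where "weight \<nu> = (\<Sum>j | \<nu> j \<noteq> 0. block_index j * \<nu> j)"

lemma mpow_rho_star_one: "mpow rho_star_one \<nu> = 2 ^ weight \<nu>"
  by (simp add: mpow_def weight_def rho_star_one_def block_index_def power_sum power_mult)

lemma S_set_eq: "S_set m = {\<nu> \<in> multi_indices. weight \<nu> = m}"
  by (simp add: S_set_def mpow_rho_star_one)

text \<open>The sum may run over all the blocks instead of the support, and
  \<open>block_index\<close> is constant on each block.\<close>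

lemma weight_eq_sum_blocks:
  assumes "\<And>j. j \<notin> (\<Union>k\<in>{1..m}. I_block k) \<Longrightarrow> \<nu> j = 0"
  shows "weight \<nu> = (\<Sum>k = 1..m. k * sum \<nu> (I_block k))"
proof -
  have "weight \<nu> = (\<Sum>j\<in>(\<Union>k\<in>{1..m}. I_block k). block_index j * \<nu> j)"
    unfolding weight_def
  proof (rule sum.mono_neutral_left)
    show "{j. \<nu> j \<noteq> 0} \<subseteq> (\<Union>k\<in>{1..m}. I_block k)"
      using assms by (metis (mono_tags, lifting) mem_Collect_eq subsetI)
  qed (use finite_I_block in auto)
  also have "\<dots> = (\<Sum>k = 1..m. \<Sum>j\<in>I_block k. block_index j * \<nu> j)"
    using disjoint_family_I_block[of m] finite_I_block
    by (intro sum.UNION_disjoint) (auto simp: disjoint_family_on_def)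
  also have "\<dots> = (\<Sum>k = 1..m. k * sum \<nu> (I_block k))"
    unfolding sum_distrib_left by (intro sum.cong) (auto simp: block_index_eq)
  finally show ?thesis .
qed

text \<open>A single nonzero entry at \<open>j\<close> already contributes at least
  \<open>block_index j\<close> to the weight, so its block has number at most
  \<open>m\<close>.\<close>

lemma S_set_support:
  assumes "\<nu> \<in> S_set m" "j \<notin> (\<Union>k\<in>{1..m}. I_block k)"
  shows "\<nu> j = 0"
proof (rule ccontr)
  assume j: "\<nu> j \<noteq> 0"
  have \<nu>: "\<nu> \<in> multi_indices" "weight \<nu> = m"
    using assms(1) by (auto simp: S_set_eq)
  then have fin: "finite {j. \<nu> j \<noteq> 0}" and "j \<ge> 1"
    using j by (cases j; auto simp: multi_indices_def)+
  have "block_index j \<le> block_index j * \<nu> j" using j by simp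
  also have "\<dots> \<le> m"
    unfolding \<nu>(2)[symmetric] weight_def using j by (intro member_le_sum[OF _ _ fin]) auto
  finally show False
    using block_index_props[OF \<open>j \<ge> 1\<close>] assms(2) by auto
qed

text \<open>This form depends on \<nu> only through its support and block sums. Membership in
  \<open>multi_indices\<close> is implicit: the blocks are finite and none contains 0.\<close>

lemma S_set_eq_block_sums:
  "S_set m = {\<nu>. (\<forall>j. j \<notin> (\<Union>k\<in>{1..m}. I_block k) \<longrightarrow> \<nu> j = 0) \<and>
     (\<Sum>k = 1..m. k * sum \<nu> (I_block k)) = m}" (is "_ = ?R")
proof (intro equalityI subsetI)
  fix \<nu> assume "\<nu> \<in> S_set m"
  then show "\<nu> \<in> ?R"
    using S_set_support[of \<nu> m] weight_eq_sum_blocks[of m \<nu>] by (auto simp: S_set_eq)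
next
  fix \<nu> assume R: "\<nu> \<in> ?R"
  then have z: "\<And>j. j \<notin> (\<Union>k\<in>{1..m}. I_block k) \<Longrightarrow> \<nu> j = 0" by blast
  have "finite {j. \<nu> j \<noteq> 0}"
  proof (rule finite_subset)
    show "{j. \<nu> j \<noteq> 0} \<subseteq> (\<Union>k\<in>{1..m}. I_block k)"
      using z by (metis (mono_tags, lifting) mem_Collect_eq subsetI)
  qed (use finite_I_block in auto)
  moreover have "\<nu> 0 = 0"
    using z I_block_ge_1[of 0] by force
  ultimately show "\<nu> \<in> S_set m"
    using R weight_eq_sum_blocks[of m \<nu>, OF z] by (simp add: S_set_eq multi_indices_def)
qed

section \<open>Counting\<close>

lemma finite_Q_set: "finite (Q_set m)"
proof (rule finite_subset)
  show "Q_set m \<subseteq> {1..m} \<rightarrow>\<^sub>E {..m}"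
  proof
    fix N assume N: "N \<in> Q_set m"
    have "N k \<le> m" if "k \<in> {1..m}" for k
    proof -
      have "N k \<le> k * N k" using that by simp
      also have "\<dots> \<le> (\<Sum>k = 1..m. k * N k)"
        using that by (intro member_le_sum) auto
      finally show ?thesis using N by (simp add: Q_set_def)
    qed
    with N show "N \<in> {1..m} \<rightarrow>\<^sub>E {..m}"
      by (auto simp: Q_set_def PiE_iff)
  qed
qed (simp add: finite_PiE)

text \<open>Block numbers are at least 1, so the plain sum of the entries is at most the weight
  \<open>m\<close>; there are finitely many weak compositions of each
  \<open>n \<le> m\<close>.\<close>

lemma finite_S_set: "finite (S_set m)"
proof (rule finite_subset)
  let ?U = "\<Union>k\<in>{1..m}. I_block k"
  show "S_set m \<subseteq> (\<Union>n\<in>{..m}. {\<nu>. (\<forall>j. j \<notin> ?U \<longrightarrow> \<nu> j = 0) \<and> sum \<nu> ?U = n})"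
  proof
    fix \<nu> assume "\<nu> \<in> S_set m"
    then have \<nu>: "\<forall>j. j \<notin> ?U \<longrightarrow> \<nu> j = 0" "(\<Sum>k = 1..m. k * sum \<nu> (I_block k)) = m"
      by (auto simp: S_set_eq_block_sums)
    have "sum \<nu> ?U = (\<Sum>k = 1..m. sum \<nu> (I_block k))"
      using disjoint_family_I_block[of m] finite_I_block
      by (intro sum.UNION_disjoint) (auto simp: disjoint_family_on_def)
    also have "\<dots> \<le> (\<Sum>k = 1..m. k * sum \<nu> (I_block k))"
      by (intro sum_mono) simp
    finally show "\<nu> \<in> (\<Union>n\<in>{..m}. {\<nu>. (\<forall>j. j \<notin> ?U \<longrightarrow> \<nu> j = 0) \<and> sum \<nu> ?U = n})"
      using \<nu> by auto
  qed
  show "finite (\<Union>n\<in>{..m}. {\<nu>. (\<forall>j. j \<notin> ?U \<longrightarrow> \<nu> j = (0::nat)) \<and> sum \<nu> ?U = n})"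
    using finite_I_block by (intro finite_UN_I finite_weak_compositions) auto
qed

lemma card_S_set:
  "card (S_set m) = (\<Sum>N\<in>Q_set m. \<Prod>k = 1..m. (N k + card (I_block k) - 1) choose N k)"
proof -
  let ?C = "\<lambda>N. {\<nu>. (\<forall>j. j \<notin> (\<Union>k\<in>{1..m}. I_block k) \<longrightarrow> \<nu> j = 0) \<and>
     (\<forall>k\<in>{1..m}. sum \<nu> (I_block k) = N k)}"
  have S: "S_set m = (\<Union>N\<in>Q_set m. ?C N)"
  proof (intro equalityI subsetI)
    fix \<nu> assume "\<nu> \<in> S_set m"
    then show "\<nu> \<in> (\<Union>N\<in>Q_set m. ?C N)"
      \<comment> \<open>The witness is the tuple of block sums, restricted to be extensional as
        \<open>Q_set\<close> demands.\<close>
      by (intro UN_I[of "restrict (\<lambda>k. sum \<nu> (I_block k)) {1..m}"])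
        (auto simp: S_set_eq_block_sums Q_set_def)
  next
    fix \<nu> assume "\<nu> \<in> (\<Union>N\<in>Q_set m. ?C N)"
    then obtain N where N: "N \<in> Q_set m" "\<nu> \<in> ?C N" by blast
    then have "(\<Sum>k = 1..m. k * sum \<nu> (I_block k)) = (\<Sum>k = 1..m. k * N k)"
      by (intro sum.cong) auto
    with N show "\<nu> \<in> S_set m"
      by (auto simp: S_set_eq_block_sums Q_set_def)
  qed
  have "card (S_set m) = (\<Sum>N\<in>Q_set m. card (?C N))"
    unfolding S
  proof (rule card_UN_disjoint[OF finite_Q_set])
    show "\<forall>N\<in>Q_set m. finite (?C N)"
    proof
      fix N assume "N \<in> Q_set m"
      then have "?C N \<subseteq> S_set m" unfolding S by (rule UN_upper)
      then show "finite (?C N)" using finite_S_set by (rule finite_subset)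
    qed
    show "\<forall>N\<in>Q_set m. \<forall>N'\<in>Q_set m. N \<noteq> N' \<longrightarrow> ?C N \<inter> ?C N' = {}"
    proof (intro ballI impI equals0I)
      fix N N' \<nu> assume N: "N \<in> Q_set m" "N' \<in> Q_set m" "N \<noteq> N'" "\<nu> \<in> ?C N \<inter> ?C N'"
      \<comment> \<open>Both tuples equal the block sums of \<nu> on \<open>{1..m}\<close>, and
        extensional functions are determined by their values there.\<close>
      then have "N = N'"
        by (intro PiE_ext[of N "{1..m}" "\<lambda>_. UNIV" N']) (auto simp: Q_set_def)
      with N show False by simp
    qed
  qed
  also have "\<dots> = (\<Sum>N\<in>Q_set m. \<Prod>k = 1..m. (N k + card (I_block k) - 1) choose N k)"
    by (intro sum.cong refl card_block_compositions disjoint_family_I_block finite_I_block) simp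
  finally show ?thesis .
qed

text \<open>Only the empty tuple, encoded as the constant \<open>undefined\<close>, remains, and it
  contributes an empty product.\<close>

lemma card_S_set_0: "card (S_set 0) = 1"
proof -
  have "Q_set 0 = {\<lambda>_. undefined}" by (auto simp: Q_set_def)
  then show ?thesis by (simp add: card_S_set)
qed

lemma Lambda_set_eq:
  assumes "0 < \<epsilon>" "\<epsilon> \<le> 1"
  shows "Lambda_set \<epsilon> rho_star_one = (\<Union>k\<in>{0..m_of \<epsilon>}. S_set k)"
proof -
  have *: "1 / 2 ^ n \<ge> \<epsilon> \<longleftrightarrow> n \<le> m_of \<epsilon>" for n :: nat
  proof -
    have *: "1 / 2 ^ n \<ge> \<epsilon> \<longleftrightarrow> 2 ^ n \<le> 1 / \<epsilon>"
      using assms(1) by (simp add: pos_le_divide_eq mult.commute)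
    also have "\<dots> \<longleftrightarrow> real n \<le> log 2 (1 / \<epsilon>)"
      using assms by (simp add: le_log_iff powr_realpow)
    also have "\<dots> \<longleftrightarrow> int n \<le> \<lfloor>log 2 (1 / \<epsilon>)\<rfloor>"
      by (simp add: le_floor_iff)
    \<comment> \<open>As \<open>\<epsilon> \<le> 1\<close>, the floor is nonnegative and
      \<open>nat\<close> does not alter it.\<close>
    also have "\<dots> \<longleftrightarrow> n \<le> m_of \<epsilon>"
      using assms by (simp add: m_of_def le_nat_iff)
    finally show ?thesis .
  qed
  show ?thesis
    unfolding Lambda_set_def mpow_rho_star_one S_set_eq * by auto
qed

theorem theorem5p1:
  shows "(\<forall>m::nat. m \<ge> 1 \<longrightarrow>
            finite (S_set m) \<and>
            card (S_set m) =
              (\<Sum>N\<in>Q_set m. \<Prod>k = 1..m. (N k + card (I_block k) - 1) choose N k)) \<and>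
         (\<forall>\<epsilon>::real. 0 < \<epsilon> \<and> \<epsilon> \<le> 1 \<longrightarrow>
            finite (Lambda_set \<epsilon> rho_star_one) \<and>
            card (Lambda_set \<epsilon> rho_star_one) = (\<Sum>k = 0..m_of \<epsilon>. card (S_set k)) \<and>
            (\<Sum>k = 0..m_of \<epsilon>. card (S_set k)) =
              1 + (\<Sum>k = 1..m_of \<epsilon>. \<Sum>N\<in>Q_set k.
                     \<Prod>j = 1..k. (N j + card (I_block j) - 1) choose N j))"
proof (intro conjI allI impI)
  fix m :: nat
  show "finite (S_set m)" by (rule finite_S_set)
  show "card (S_set m) = (\<Sum>N\<in>Q_set m. \<Prod>k = 1..m. (N k + card (I_block k) - 1) choose N k)"
    by (rule card_S_set)
next
  fix \<epsilon> :: real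
  assume "0 < \<epsilon> \<and> \<epsilon> \<le> 1"
  then have L: "Lambda_set \<epsilon> rho_star_one = (\<Union>k\<in>{0..m_of \<epsilon>}. S_set k)"
    by (intro Lambda_set_eq) auto
  show "finite (Lambda_set \<epsilon> rho_star_one)"
    by (simp add: L finite_S_set)
  \<comment> \<open>The sets \<open>S_set k\<close> are disjoint because \<nu> has only one
    weight.\<close>
  show "card (Lambda_set \<epsilon> rho_star_one) = (\<Sum>k = 0..m_of \<epsilon>. card (S_set k))"
    unfolding L by (rule card_UN_disjoint) (use finite_S_set in \<open>auto simp: S_set_eq\<close>)
  have "(\<Sum>k = 0..m_of \<epsilon>. card (S_set k)) = 1 + (\<Sum>k = 1..m_of \<epsilon>. card (S_set k))"
    using sum.atLeast_Suc_atMost[of 0 "m_of \<epsilon>" "\<lambda>k. card (S_set k)"] card_S_set_0 by simp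
  then show "(\<Sum>k = 0..m_of \<epsilon>. card (S_set k)) =
      1 + (\<Sum>k = 1..m_of \<epsilon>. \<Sum>N\<in>Q_set k. \<Prod>j = 1..k. (N j + card (I_block j) - 1) choose N j)"
    by (simp only: card_S_set)
qed

end
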